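(* Suppose that: (A1) for every $\bar p=(\bar x_t,y_{t-1},p)$ in some polytopic set $\mathscr{Y}$, the quadratic program $$\min_y\ \tfrac12 y^\top Q\,y+q^\top y\quad\text{s.t.}\quad Fy=\phi,\ \ Gy\le g$$ (data depending on $\bar p$) representing the MPC problem has $Q\succ0$, is feasible, and satisfies the linear independence constraint qualification (LICQ); (A2) the maps $Q,q,F,\phi,G,g$ are locally Lipschitz and definable in $\bar p$; and (A3) $f$ is locally Lipschitz and definable. Let $p^*$ be the optimal parameter obtained with the closed-loop optimization scheme (projected gradient with conservative Jacobians) applied to the penalized problem $$\min_{p}\ \mathcal C(p)+\mathcal P_\epsilon(\epsilon(p)),\qquad \mathcal P_\epsilon(\epsilon)=c_3\|\epsilon\|_1 .$$ If the problem $\min_p\ \mathcal C(p)$ s.t. $\epsilon(p)=0$ is calm at $p^*$, and $c_2$ and $c_3$ are sufficiently large, then the MPC controller without constraint relaxation (the hard-constrained MPC) with parameter $p^*$ is recursively feasible for the closed-loop dynamics $\bar x_{t+1}=f(\bar x_t,\bar u_t)$ with $\bar u_t$ given by this MPC controller (i.e. starting from $\bar x_0$ the hard-constrained MPC problem is feasible at every $t\in\{0,\dots,T\}$), and the closed-loop constraints $$H_x\bar x_t\le h_x,\qquad H_u\bar u_t\le h_u$$ are satisfied for all $t\in\{0,\dots,T\}$.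
   Context: $\bar x_t\in\mathbb R^{n_x}$, $\bar u_t\in\mathbb R^{n_u}$, $p\in\mathscr P\subset\mathbb R^{n_p}$ with $\mathscr P$ polytopic; $\bar x_0$ and $T\in\mathbb N_{>0}$ are fixed; $Q_x\succ0$. Hard-constrained MPC: at time $t$, minimize over $(x_t,u_t)=(x_{0|t},\dots,x_{N|t},u_{0|t},\dots,u_{N-1|t})$ $$\|x_{N|t}\|_P^2+\sum_{k=0}^{N-1}\big(\|x_{k|t}\|_{Q_x}^2+\|u_{k|t}\|_{R_u}^2\big)$$ s.t. $x_{0|t}=\bar x_t$, $x_{k+1|t}=A_tx_{k|t}+B_tu_{k|t}+c_t$, $H_xx_{k|t}\le h_x$, $H_uu_{k|t}\le h_u$ ($0\le k\le N-1$), $H_{x,N}x_{N|t}\le h_{x,N}$. The parameter $p$ (e.g. $p=(P,R_u)$) may enter cost and constraints; the prediction model $(A_t,B_t,c_t)$ is either fixed or a function of $\bar x_t$ and of the previous MPC solution $y_{t-1}=(x_{t-1},u_{t-1})$ (with $y_{-1}$ given). The applied input is $\bar u_t=u_{0|t}$. Soft-constrained MPC: same, with slack variables $\epsilon_t=(\epsilon_{0|t},\dots,\epsilon_{N|t})\ge0$, additional cost $c_1\|\epsilon_t\|_2^2+c_2\|\epsilon_t\|_1$ with $c_1,c_2>0$, and state constraints replaced by $H_xx_{k|t}\le h_x+\epsilon_{k|t}$ ($0\le k\le N-1$) and $H_{x,N}x_{N|t}\le h_{x,N}+\epsilon_{N|t}$. Input constraints can always be satisfied. In the scheme producing $p^*$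 the soft-constrained MPC is the one used, and (A1)–(A2) refer to its representation as a quadratic program. LICQ: at the optimizer, the rows of $G$ associated with active inequality constraints together with the rows of $F$ are linearly independent. For given $p$, run the closed loop $\bar x_{t+1}=f(\bar x_t,u_{0|t})$, $t=0,\dots,T$, with the soft-constrained MPC; $\mathcal C(p)=\sum_{t=0}^T\|\bar x_t\|_{Q_x}^2$ is the resulting closed-loop cost and $\epsilon(p)=(\epsilon_0,\dots,\epsilon_T)$ the collection of the optimal slacks of all the MPC problems solved. Scheme: $p^{k+1}=P_{\mathscr P}[p^k-\alpha_kJ^k]$, where $P_{\mathscr P}$ is the orthogonal projector, $\alpha_k>0$, $\sum_k\alpha_k=\infty$, $\sum_k\alpha_k^2<\infty$, and $J^k$ is an element at $p^k$ of a conservative Jacobian of $p\mapsto\mathcal C(p)+\mathcal P_\epsilon(\epsilon(p))$ obtained by the chain rule along the closed loop; $p^*$ is its limit, understood as a (local) minimizer of the penalized problem. (A locally Lipschitz $\varphi$ admits the nonempty-valued, outer semicontinuous, locally bounded set-valued map $\mathcal J_\varphi$ as a conservative Jacobian if for every absolutely continuous $x:[0,1]\to\mathbb R^n$ and almost every $s$, $\frac{d}{ds}\varphi(x(s))=v\,\dot x(s)$ for all $v\in\mathcal J_\varphi(x(s))$.) Calmness: let $p^*$ be such that $\epsilon(p^* )=0$. The problem $\min_p\mathcal C(p)$ s.t. $\epsilon(p)=0$ is calm at $p^*$ if there exist $\bar\alpha\ge0$ (the calmness modulus) and $r>0$ such that for all $(p,u)$ with $\|p-p^*\|\le r$ and $\epsilon(p)=u$,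 $\mathcal C(p)+\bar\alpha\|u\|\ge\mathcal C(p^* )$. "Sufficiently large": $c_2>\|\lambda\|_\infty$, where $\lambda$ denotes the multipliers of the inequality constraints affecting the state in the hard-constrained MPC problems encountered (when these admit a solution), and $c_3$ at least as large as the calmness modulus. Definability: an o-minimal structure on $(\mathbb R,+,\cdot)$ is a collection $\mathcal O=(\mathcal O_n)_n$, each $\mathcal O_n$ a Boolean subalgebra of the power set of $\mathbb R^n$, containing all semialgebraic subsets of $\mathbb R^n$, closed under Cartesian products and under projection $\mathbb R^{n+1}\to\mathbb R^n$ onto the first $n$ coordinates, and such that $\mathcal O_1$ consists exactly of finite unions of points and intervals. A set is definable if it belongs to a fixed such $\mathcal O$; a function is definable if its graph is. *)

theory Defs
  imports "HOL-Analysis.Analysis"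
begin

section \<open>O-minimal structures and definability\<close>

text \<open>Points of \<open>\<real>\<^sup>n\<close> are lists of length \<open>n\<close>, since an o-minimal structure ranges over all dimensions.\<close>

definition Rn :: "nat \<Rightarrow> real list set" where
  "Rn n = {xs. length xs = n}"

inductive_set polynomial_fun :: "nat \<Rightarrow> (real list \<Rightarrow> real) set" for n :: nat where
  const: "(\<lambda>_. c) \<in> polynomial_fun n"
| coord: "i < n \<Longrightarrow> (\<lambda>xs. xs ! i) \<in> polynomial_fun n"
| add: "a \<in> polynomial_fun n \<Longrightarrow> b \<in> polynomial_fun n \<Longrightarrow> (\<lambda>xs. a xs + b xs) \<in> polynomial_fun n"
| mult: "a \<in> polynomial_fun n \<Longrightarrow> b \<in> polynomial_fun n \<Longrightarrow> (\<lambda>xs. a xs * b xs) \<in> polynomial_fun n"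

inductive_set semialgebraic :: "nat \<Rightarrow> real list set set" for n :: nat where
  zero: "a \<in> polynomial_fun n \<Longrightarrow> {xs \<in> Rn n. a xs = 0} \<in> semialgebraic n"
| pos: "a \<in> polynomial_fun n \<Longrightarrow> {xs \<in> Rn n. a xs > 0} \<in> semialgebraic n"
| union: "A \<in> semialgebraic n \<Longrightarrow> B \<in> semialgebraic n \<Longrightarrow> A \<union> B \<in> semialgebraic n"
| compl: "A \<in> semialgebraic n \<Longrightarrow> Rn n - A \<in> semialgebraic n"

definition o_minimal :: "(nat \<Rightarrow> real list set set) \<Rightarrow> bool" where
  "o_minimal Om \<longleftrightarrow>
     (\<forall>n. Om n \<subseteq> Pow (Rn n)) \<and>
     (\<forall>n. \<forall>A\<in>Om n. \<forall>B\<in>Om n. A \<union> B \<in> Om n) \<and>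
     (\<forall>n. \<forall>A\<in>Om n. Rn n - A \<in> Om n) \<and>
     (\<forall>n. semialgebraic n \<subseteq> Om n) \<and>
     (\<forall>m n. \<forall>A\<in>Om m. \<forall>B\<in>Om n. {xs @ ys |xs ys. xs \<in> A \<and> ys \<in> B} \<in> Om (m + n)) \<and>
     (\<forall>n. \<forall>A\<in>Om (Suc n). take n ` A \<in> Om n) \<and>
     Om 1 = {(\<lambda>x. [x]) ` (\<Union>F) |F. finite F \<and> (\<forall>I\<in>F. (\<exists>a. I = {a}) \<or> is_interval (I :: real set))}"

text \<open>The order of the coordinates is immaterial: an o-minimal structure is closed under
  coordinate permutations.\<close>

definition definable_set :: "(nat \<Rightarrow> real list set set) \<Rightarrow> 'a::euclidean_space set \<Rightarrow> bool" where
  "definable_set Om S \<longleftrightarrow>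
     (\<exists>bs. distinct bs \<and> set bs = (Basis :: 'a set) \<and> (\<lambda>x. map (\<lambda>b. x \<bullet> b) bs) ` S \<in> Om DIM('a))"

definition definable_on ::
  "(nat \<Rightarrow> real list set set) \<Rightarrow> 'a::euclidean_space set \<Rightarrow> ('a \<Rightarrow> 'b::euclidean_space) \<Rightarrow> bool" where
  "definable_on Om S \<phi> \<longleftrightarrow> definable_set Om ((\<lambda>x. (x, \<phi> x)) ` S)"


section \<open>Conservative Jacobians and the projected gradient scheme\<close>

definition locally_lipschitz_on :: "'a::metric_space set \<Rightarrow> ('a \<Rightarrow> 'b::metric_space) \<Rightarrow> bool" where
  "locally_lipschitz_on S \<phi> \<longleftrightarrow> (\<forall>x\<in>S. \<exists>r>0. \<exists>L. L-lipschitz_on (ball x r \<inter> S) \<phi>)"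

definition absolutely_continuous_path :: "(real \<Rightarrow> 'a::real_normed_vector) \<Rightarrow> bool" where
  "absolutely_continuous_path \<gamma> \<longleftrightarrow>
     (\<forall>e>0. \<exists>d>0. \<forall>I. finite I \<longrightarrow> (\<forall>(a, b)\<in>I. 0 \<le> a \<and> a \<le> b \<and> b \<le> 1) \<longrightarrow>
        pairwise (\<lambda>(a, b) (a', b'). {a<..<b} \<inter> {a'<..<b'} = {}) I \<longrightarrow>
        (\<Sum>(a, b)\<in>I. b - a) < d \<longrightarrow> (\<Sum>(a, b)\<in>I. norm (\<gamma> b - \<gamma> a)) < e)"

text \<open>The second and third requirements are outer semicontinuity (closed graph) and local
  boundedness; curves are confined to the domain \<open>S\<close> of \<open>\<phi>\<close>.\<close>

definition conservative_jacobian_on ::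
  "'a::euclidean_space set \<Rightarrow> ('a \<Rightarrow> 'b::euclidean_space) \<Rightarrow> ('a \<Rightarrow> ('a \<Rightarrow>\<^sub>L 'b) set) \<Rightarrow> bool" where
  "conservative_jacobian_on S \<phi> J \<longleftrightarrow>
     locally_lipschitz_on S \<phi> \<and>
     (\<forall>x\<in>S. J x \<noteq> {}) \<and>
     closedin (top_of_set (S \<times> UNIV)) (Sigma S J) \<and>
     (\<forall>x\<in>S. \<exists>r>0. bounded (\<Union>x'\<in>ball x r \<inter> S. J x')) \<and>
     (\<forall>\<gamma>. absolutely_continuous_path \<gamma> \<and> \<gamma> ` {0..1} \<subseteq> S \<longrightarrow>
        (AE s in lebesgue_on {0..1}. \<forall>V\<in>J (\<gamma> s).
           ((\<lambda>s. \<phi> (\<gamma> s)) has_vector_derivative blinfun_apply V (vector_derivative \<gamma> (at s))) (at s)))"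

definition projected_gradient ::
  "'a::euclidean_space set \<Rightarrow> ('a \<Rightarrow> ('a \<Rightarrow>\<^sub>L real) set) \<Rightarrow> (nat \<Rightarrow> real) \<Rightarrow> (nat \<Rightarrow> 'a) \<Rightarrow> bool" where
  "projected_gradient S J \<alpha> p \<longleftrightarrow>
     (\<forall>k. \<alpha> k > 0) \<and> \<not> summable \<alpha> \<and> summable (\<lambda>k. (\<alpha> k)\<^sup>2) \<and> p 0 \<in> S \<and>
     (\<forall>k. \<exists>g. blinfun_inner_left g \<in> J (p k) \<and> p (Suc k) = closest_point S (p k - \<alpha> k *\<^sub>R g))"

definition local_minimizer_on :: "'a::metric_space set \<Rightarrow> ('a \<Rightarrow> real) \<Rightarrow> 'a \<Rightarrow> bool" where
  "local_minimizer_on S \<Phi> p \<longleftrightarrow> p \<in> S \<and> (\<exists>r>0. \<forall>p'\<in>S. dist p' p \<le> r \<longrightarrow> \<Phi> p \<le> \<Phi> p')"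


section \<open>Quadratic programs\<close>

definition pos_def :: "real^'n^'n \<Rightarrow> bool" where
  "pos_def M \<longleftrightarrow> transpose M = M \<and> (\<forall>x. x \<noteq> 0 \<longrightarrow> x \<bullet> (M *v x) > 0)"

definition quad :: "real^'n^'n \<Rightarrow> real^'n \<Rightarrow> real" where
  "quad M x = x \<bullet> (M *v x)"

definition qp_cost :: "real^'n^'n \<Rightarrow> real^'n \<Rightarrow> real^'n \<Rightarrow> real" where
  "qp_cost Q q y = 1 / 2 * (y \<bullet> (Q *v y)) + q \<bullet> y"

definition qp_feasible ::
  "real^'n^'e \<Rightarrow> real^'e \<Rightarrow> real^'n^'i \<Rightarrow> real^'i \<Rightarrow> real^'n \<Rightarrow> bool" where
  "qp_feasible F \<phi> G g y \<longleftrightarrow> F *v y = \<phi> \<and> G *v y \<le> g"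

text \<open>Injectivity makes this independence of the indexed family of rows, not of the set of rows.\<close>

definition licq ::
  "real^'n^'n \<Rightarrow> real^'n \<Rightarrow> real^'n^'e \<Rightarrow> real^'e \<Rightarrow> real^'n^'i \<Rightarrow> real^'i \<Rightarrow> bool" where
  "licq Q q F \<phi> G g \<longleftrightarrow>
     (\<forall>y. is_arg_min (qp_cost Q q) (qp_feasible F \<phi> G g) y \<longrightarrow>
        (let R = case_sum (\<lambda>i. row i G) (\<lambda>j. row j F);
             I = Inl ` {i. (G *v y) $ i = g $ i} \<union> range Inr
         in inj_on R I \<and> independent (R ` I)))"


section \<open>The MPC problems\<close>

text \<open>The horizon is a finite linearly ordered index type \<open>'h\<close>: the stages \<open>0, \<dots>, N - 1\<close> are the
  elements of \<open>'h\<close> in increasing order, and \<open>N = CARD('h)\<close>. Predicted states are indexed by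
  \<open>'h option\<close>, where \<open>None\<close> is the terminal stage \<open>N\<close>.\<close>

definition first_stage :: "'h::{finite,linorder}" where
  "first_stage = Min UNIV"

definition next_stage :: "'h::{finite,linorder} \<Rightarrow> 'h option" where
  "next_stage k = (if {k<..} = {} then None else Some (Min {k<..}))"

text \<open>Predicted states and inputs; slacks of the stage and of the terminal state constraints;
  the parameter \<open>(x, y, p)\<close> made of current state, previous solution and design parameter.\<close>

type_synonym ('nx, 'nu, 'h) plan = "(real^'nx^('h option)) \<times> (real^'nu^'h)"
type_synonym ('mx, 'mN, 'h) slack = "(real^'mx^'h) \<times> (real^'mN)"
type_synonym ('nx, 'nu, 'np, 'h) qparam = "(real^'nx) \<times> ('nx, 'nu, 'h) plan \<times> (real^'np)"

text \<open>\<open>model_*\<close> depend on the current state and the previous solution (constant functions give a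
  fixed prediction model); the remaining function-valued fields depend on the design parameter.\<close>

record ('nx, 'nu, 'np, 'mx, 'mu, 'mN, 'h) mpc =
  model_A :: "real^'nx \<Rightarrow> ('nx::finite, 'nu::finite, 'h::{finite,linorder}) plan \<Rightarrow> real^'nx^'nx"
  model_B :: "real^'nx \<Rightarrow> ('nx, 'nu, 'h) plan \<Rightarrow> real^'nu^'nx"
  model_c :: "real^'nx \<Rightarrow> ('nx, 'nu, 'h) plan \<Rightarrow> real^'nx"
  cost_Qx :: "real^'nx^'nx"
  cost_P  :: "real^('np::finite) \<Rightarrow> real^'nx^'nx"
  cost_Ru :: "real^'np \<Rightarrow> real^'nu^'nu"
  con_Hx  :: "real^'np \<Rightarrow> real^'nx^('mx::finite)"
  con_hx  :: "real^'np \<Rightarrow> real^'mx"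
  con_Hu  :: "real^'np \<Rightarrow> real^'nu^('mu::finite)"
  con_hu  :: "real^'np \<Rightarrow> real^'mu"
  con_HxN :: "real^'np \<Rightarrow> real^'nx^('mN::finite)"
  con_hxN :: "real^'np \<Rightarrow> real^'mN"
  pen_c1  :: real
  pen_c2  :: real

fun mpc_cost ::
  "('nx::finite, 'nu::finite, 'np::finite, 'mx::finite, 'mu::finite, 'mN::finite,
    'h::{finite,linorder}) mpc \<Rightarrow> real^'np \<Rightarrow> ('nx, 'nu, 'h) plan \<Rightarrow> real" where
  "mpc_cost D p (x, u) = quad (cost_P D p) (x $ None)
     + (\<Sum>k\<in>UNIV. quad (cost_Qx D) (x $ Some k) + quad (cost_Ru D p) (u $ k))"

text \<open>Constraints common to the hard- and the soft-constrained problem.\<close>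

fun base_feasible ::
  "('nx::finite, 'nu::finite, 'np::finite, 'mx::finite, 'mu::finite, 'mN::finite,
    'h::{finite,linorder}) mpc \<Rightarrow> ('nx, 'nu, 'np, 'h) qparam \<Rightarrow> ('nx, 'nu, 'h) plan \<Rightarrow> bool" where
  "base_feasible D (xb, yp, p) (x, u) \<longleftrightarrow>
     x $ Some first_stage = xb \<and>
     (\<forall>k. x $ next_stage k = model_A D xb yp *v (x $ Some k) + model_B D xb yp *v (u $ k) + model_c D xb yp) \<and>
     (\<forall>k. con_Hu D p *v (u $ k) \<le> con_hu D p)"

fun hard_feasible ::
  "('nx::finite, 'nu::finite, 'np::finite, 'mx::finite, 'mu::finite, 'mN::finite,
    'h::{finite,linorder}) mpc \<Rightarrow> ('nx, 'nu, 'np, 'h) qparam \<Rightarrow> ('nx, 'nu, 'h) plan \<Rightarrow> bool" where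
  "hard_feasible D (xb, yp, p) (x, u) \<longleftrightarrow>
     base_feasible D (xb, yp, p) (x, u) \<and>
     (\<forall>k. con_Hx D p *v (x $ Some k) \<le> con_hx D p) \<and>
     con_HxN D p *v (x $ None) \<le> con_hxN D p"

definition hard_optimal ::
  "('nx::finite, 'nu::finite, 'np::finite, 'mx::finite, 'mu::finite, 'mN::finite,
    'h::{finite,linorder}) mpc \<Rightarrow> ('nx, 'nu, 'np, 'h) qparam \<Rightarrow> ('nx, 'nu, 'h) plan \<Rightarrow> bool" where
  "hard_optimal D pb = is_arg_min (mpc_cost D (snd (snd pb))) (hard_feasible D pb)"

definition hard_mpc ::
  "('nx::finite, 'nu::finite, 'np::finite, 'mx::finite, 'mu::finite, 'mN::finite,
    'h::{finite,linorder}) mpc \<Rightarrow> ('nx, 'nu, 'np, 'h) qparam \<Rightarrow> ('nx, 'nu, 'h) plan" where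
  "hard_mpc D pb = arg_min (mpc_cost D (snd (snd pb))) (hard_feasible D pb)"

definition norm1 :: "'a::euclidean_space \<Rightarrow> real" where
  "norm1 e = (\<Sum>b\<in>Basis. \<bar>e \<bullet> b\<bar>)"

fun soft_cost ::
  "('nx::finite, 'nu::finite, 'np::finite, 'mx::finite, 'mu::finite, 'mN::finite,
    'h::{finite,linorder}) mpc \<Rightarrow> real^'np \<Rightarrow> ('nx, 'nu, 'h) plan \<times> ('mx, 'mN, 'h) slack \<Rightarrow> real" where
  "soft_cost D p (y, e) = mpc_cost D p y + pen_c1 D * (norm e)\<^sup>2 + pen_c2 D * norm1 e"

fun soft_feasible ::
  "('nx::finite, 'nu::finite, 'np::finite, 'mx::finite, 'mu::finite, 'mN::finite,
    'h::{finite,linorder}) mpc \<Rightarrow> ('nx, 'nu, 'np, 'h) qparam \<Rightarrow>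
    ('nx, 'nu, 'h) plan \<times> ('mx, 'mN, 'h) slack \<Rightarrow> bool" where
  "soft_feasible D (xb, yp, p) ((x, u), (e, eN)) \<longleftrightarrow>
     base_feasible D (xb, yp, p) (x, u) \<and>
     (\<forall>k. 0 \<le> e $ k \<and> con_Hx D p *v (x $ Some k) \<le> con_hx D p + e $ k) \<and>
     0 \<le> eN \<and> con_HxN D p *v (x $ None) \<le> con_hxN D p + eN"

definition soft_mpc ::
  "('nx::finite, 'nu::finite, 'np::finite, 'mx::finite, 'mu::finite, 'mN::finite,
    'h::{finite,linorder}) mpc \<Rightarrow> ('nx, 'nu, 'np, 'h) qparam \<Rightarrow>
    ('nx, 'nu, 'h) plan \<times> ('mx, 'mN, 'h) slack" where
  "soft_mpc D pb = arg_min (soft_cost D (snd (snd pb))) (soft_feasible D pb)"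

subsection \<open>Representation of the soft-constrained MPC as a quadratic program\<close>

type_synonym ('nx, 'nu, 'mx, 'mN, 'h) qp_index =
  "(('h option \<times> 'nx) + ('h \<times> 'nu)) + (('h \<times> 'mx) + 'mN)"

fun stack ::
  "('nx::finite, 'nu::finite, 'h::finite) plan \<times> ('mx::finite, 'mN::finite, 'h) slack \<Rightarrow>
    real^(('nx, 'nu, 'mx, 'mN, 'h) qp_index)" where
  "stack ((x, u), (e, eN)) = (\<chi> i. case i of
       Inl (Inl (k, j)) \<Rightarrow> x $ k $ j
     | Inl (Inr (k, j)) \<Rightarrow> u $ k $ j
     | Inr (Inl (k, j)) \<Rightarrow> e $ k $ j
     | Inr (Inr j) \<Rightarrow> eN $ j)"

text \<open>Costs are compared on feasible points only, because the 1-norm of the slacks is linear only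
  for nonnegative slacks.\<close>

definition qp_represents ::
  "('nx::finite, 'nu::finite, 'np::finite, 'mx::finite, 'mu::finite, 'mN::finite,
    'h::{finite,linorder}) mpc \<Rightarrow> ('nx, 'nu, 'np, 'h) qparam \<Rightarrow>
    real^(('nx, 'nu, 'mx, 'mN, 'h) qp_index)^(('nx, 'nu, 'mx, 'mN, 'h) qp_index) \<Rightarrow>
    real^(('nx, 'nu, 'mx, 'mN, 'h) qp_index) \<Rightarrow>
    real^(('nx, 'nu, 'mx, 'mN, 'h) qp_index)^('e::finite) \<Rightarrow> real^'e \<Rightarrow>
    real^(('nx, 'nu, 'mx, 'mN, 'h) qp_index)^('i::finite) \<Rightarrow> real^'i \<Rightarrow> bool" where
  "qp_represents D pb Q q F \<phi> G g \<longleftrightarrow>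
     (\<forall>z. soft_feasible D pb z \<longleftrightarrow> qp_feasible F \<phi> G g (stack z)) \<and>
     (\<exists>\<kappa>. \<forall>z. soft_feasible D pb z \<longrightarrow> soft_cost D (snd (snd pb)) z = qp_cost Q q (stack z) + \<kappa>)"

subsection \<open>Multipliers of the hard-constrained MPC\<close>

fun lagrangian ::
  "('nx::finite, 'nu::finite, 'np::finite, 'mx::finite, 'mu::finite, 'mN::finite,
    'h::{finite,linorder}) mpc \<Rightarrow> ('nx, 'nu, 'np, 'h) qparam \<Rightarrow>
    real^'nx \<Rightarrow> real^'nx^('h::{finite,linorder}) \<Rightarrow> real^'mu^('h::{finite,linorder}) \<Rightarrow> ('mx, 'mN, 'h) slack \<Rightarrow> ('nx, 'nu, 'h) plan \<Rightarrow> real" where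
  "lagrangian D (xb, yp, p) \<nu>0 \<nu> \<mu> (l, lN) (x, u) =
     mpc_cost D p (x, u)
     + \<nu>0 \<bullet> (xb - x $ Some first_stage)
     + (\<Sum>k\<in>UNIV. \<nu> $ k \<bullet> (model_A D xb yp *v (x $ Some k) + model_B D xb yp *v (u $ k)
          + model_c D xb yp - x $ next_stage k))
     + (\<Sum>k\<in>UNIV. \<mu> $ k \<bullet> (con_Hu D p *v (u $ k) - con_hu D p))
     + (\<Sum>k\<in>UNIV. l $ k \<bullet> (con_Hx D p *v (x $ Some k) - con_hx D p))
     + lN \<bullet> (con_HxN D p *v (x $ None) - con_hxN D p)"

text \<open>KKT conditions at \<open>(x, u)\<close>; \<open>(l, lN)\<close> are the multipliers of the state inequality constraints.
  For nonnegative multipliers at a feasible point, each vanishing inner product is componentwise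
  complementary slackness.\<close>

fun state_multiplier ::
  "('nx::finite, 'nu::finite, 'np::finite, 'mx::finite, 'mu::finite, 'mN::finite,
    'h::{finite,linorder}) mpc \<Rightarrow> ('nx, 'nu, 'np, 'h) qparam \<Rightarrow> ('nx, 'nu, 'h) plan \<Rightarrow>
    ('mx, 'mN, 'h) slack \<Rightarrow> bool" where
  "state_multiplier D (xb, yp, p) (x, u) (l, lN) \<longleftrightarrow>
     hard_feasible D (xb, yp, p) (x, u) \<and>
     (\<exists>\<nu>0 \<nu> \<mu>.
        (lagrangian D (xb, yp, p) \<nu>0 \<nu> \<mu> (l, lN) has_derivative (\<lambda>_. 0)) (at (x, u)) \<and>
        (\<forall>k. 0 \<le> \<mu> $ k \<and> \<mu> $ k \<bullet> (con_Hu D p *v (u $ k) - con_hu D p) = 0) \<and>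
        (\<forall>k. 0 \<le> l $ k \<and> l $ k \<bullet> (con_Hx D p *v (x $ Some k) - con_hx D p) = 0) \<and>
        0 \<le> lN \<and> lN \<bullet> (con_HxN D p *v (x $ None) - con_hxN D p) = 0)"


section \<open>Closed loop\<close>

definition first_input :: "('nx::finite, 'nu::finite, 'h::{finite,linorder}) plan \<Rightarrow> real^'nu" where
  "first_input y = snd y $ first_stage"

text \<open>\<open>closed_loop f K x0 y0 p t\<close> is the pair of the state at time \<open>t\<close> and the MPC solution at time
  \<open>t - 1\<close>, for the MPC law \<open>K\<close>.\<close>

fun closed_loop ::
  "((real^'nx) \<times> (real^'nu) \<Rightarrow> real^'nx) \<Rightarrow> (('nx, 'nu, 'np, 'h) qparam \<Rightarrow> ('nx, 'nu, 'h) plan) \<Rightarrow>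
    real^('nx::finite) \<Rightarrow> ('nx, 'nu::finite, 'h::{finite,linorder}) plan \<Rightarrow> real^('np::finite) \<Rightarrow>
    nat \<Rightarrow> (real^'nx) \<times> ('nx, 'nu, 'h) plan" where
  "closed_loop f K x0 y0 p 0 = (x0, y0)"
| "closed_loop f K x0 y0 p (Suc t) =
     (case closed_loop f K x0 y0 p t of (x, y) \<Rightarrow>
        (f (x, first_input (K (x, y, p))), K (x, y, p)))"

definition closed_loop_param ::
  "((real^'nx) \<times> (real^'nu) \<Rightarrow> real^'nx) \<Rightarrow> (('nx, 'nu, 'np, 'h) qparam \<Rightarrow> ('nx, 'nu, 'h) plan) \<Rightarrow>
    real^('nx::finite) \<Rightarrow> ('nx, 'nu::finite, 'h::{finite,linorder}) plan \<Rightarrow> real^('np::finite) \<Rightarrow>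
    nat \<Rightarrow> ('nx, 'nu, 'np, 'h) qparam" where
  "closed_loop_param f K x0 y0 p t = (case closed_loop f K x0 y0 p t of (x, y) \<Rightarrow> (x, y, p))"

definition soft_param ::
  "('nx::finite, 'nu::finite, 'np::finite, 'mx::finite, 'mu::finite, 'mN::finite,
    'h::{finite,linorder}) mpc \<Rightarrow> ((real^'nx) \<times> (real^'nu) \<Rightarrow> real^'nx) \<Rightarrow>
    real^'nx \<Rightarrow> ('nx, 'nu, 'h) plan \<Rightarrow> real^'np \<Rightarrow> nat \<Rightarrow> ('nx, 'nu, 'np, 'h) qparam" where
  "soft_param D f = closed_loop_param f (\<lambda>pb. fst (soft_mpc D pb))"

definition hard_param ::
  "('nx::finite, 'nu::finite, 'np::finite, 'mx::finite, 'mu::finite, 'mN::finite,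
    'h::{finite,linorder}) mpc \<Rightarrow> ((real^'nx) \<times> (real^'nu) \<Rightarrow> real^'nx) \<Rightarrow>
    real^'nx \<Rightarrow> ('nx, 'nu, 'h) plan \<Rightarrow> real^'np \<Rightarrow> nat \<Rightarrow> ('nx, 'nu, 'np, 'h) qparam" where
  "hard_param D f = closed_loop_param f (hard_mpc D)"

definition cl_cost ::
  "('nx::finite, 'nu::finite, 'np::finite, 'mx::finite, 'mu::finite, 'mN::finite,
    'h::{finite,linorder}) mpc \<Rightarrow> ((real^'nx) \<times> (real^'nu) \<Rightarrow> real^'nx) \<Rightarrow>
    real^'nx \<Rightarrow> ('nx, 'nu, 'h) plan \<Rightarrow> nat \<Rightarrow> real^'np \<Rightarrow> real" where
  "cl_cost D f x0 y0 T p = (\<Sum>t\<le>T. quad (cost_Qx D) (fst (soft_param D f x0 y0 p t)))"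

definition cl_slack ::
  "('nx::finite, 'nu::finite, 'np::finite, 'mx::finite, 'mu::finite, 'mN::finite,
    'h::{finite,linorder}) mpc \<Rightarrow> ((real^'nx) \<times> (real^'nu) \<Rightarrow> real^'nx) \<Rightarrow>
    real^'nx \<Rightarrow> ('nx, 'nu, 'h) plan \<Rightarrow> real^'np \<Rightarrow> nat \<Rightarrow> ('mx, 'mN, 'h) slack" where
  "cl_slack D f x0 y0 p t = snd (soft_mpc D (soft_param D f x0 y0 p t))"

definition penalized_cost ::
  "('nx::finite, 'nu::finite, 'np::finite, 'mx::finite, 'mu::finite, 'mN::finite,
    'h::{finite,linorder}) mpc \<Rightarrow> ((real^'nx) \<times> (real^'nu) \<Rightarrow> real^'nx) \<Rightarrow>
    real^'nx \<Rightarrow> ('nx, 'nu, 'h) plan \<Rightarrow> nat \<Rightarrow> real \<Rightarrow> real^'np \<Rightarrow> real" where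
  "penalized_cost D f x0 y0 T c3 p =
     cl_cost D f x0 y0 T p + c3 * (\<Sum>t\<le>T. norm1 (cl_slack D f x0 y0 p t))"

text \<open>The chain rule along the closed loop, from conservative Jacobians \<open>JS\<close>, \<open>Jf\<close>, \<open>Jn\<close> of the
  soft-constrained MPC solution map, of the dynamics and of the 1-norm. \<open>X t h\<close> and \<open>Z t h\<close> are the
  sensitivities, in the parameter direction \<open>h\<close>, of the state and of the MPC solution (plan and
  slacks) at time \<open>t\<close>; \<open>Y t h\<close> is that of the plan at time \<open>t - 1\<close>.\<close>

definition chain_rule_jacobian ::
  "('nx::finite, 'nu::finite, 'np::finite, 'mx::finite, 'mu::finite, 'mN::finite,
    'h::{finite,linorder}) mpc \<Rightarrow> ((real^'nx) \<times> (real^'nu) \<Rightarrow> real^'nx) \<Rightarrow>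
    real^'nx \<Rightarrow> ('nx, 'nu, 'h) plan \<Rightarrow> nat \<Rightarrow> real \<Rightarrow>
    (('nx, 'nu, 'np, 'h) qparam \<Rightarrow>
       (('nx, 'nu, 'np, 'h) qparam \<Rightarrow>\<^sub>L (('nx, 'nu, 'h) plan \<times> ('mx, 'mN, 'h) slack)) set) \<Rightarrow>
    ((real^'nx) \<times> (real^'nu) \<Rightarrow> (((real^'nx) \<times> (real^'nu)) \<Rightarrow>\<^sub>L (real^'nx)) set) \<Rightarrow>
    (('mx, 'mN, 'h) slack \<Rightarrow> (('mx, 'mN, 'h) slack \<Rightarrow>\<^sub>L real) set) \<Rightarrow>
    real^'np \<Rightarrow> ((real^'np) \<Rightarrow>\<^sub>L real) set" where
  "chain_rule_jacobian D f x0 y0 T c3 JS Jf Jn p =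
     {j. \<exists>W M n X Y Z.
        (\<forall>h. X 0 h = 0 \<and> Y 0 h = 0) \<and>
        (\<forall>t\<le>T.
           W t \<in> JS (soft_param D f x0 y0 p t) \<and>
           M t \<in> Jf (fst (soft_param D f x0 y0 p t),
                     first_input (fst (soft_mpc D (soft_param D f x0 y0 p t)))) \<and>
           n t \<in> Jn (cl_slack D f x0 y0 p t) \<and>
           (\<forall>h. Z t h = blinfun_apply (W t) (X t h, Y t h, h) \<and>
                X (Suc t) h = blinfun_apply (M t) (X t h, first_input (fst (Z t h))) \<and>
                Y (Suc t) h = fst (Z t h))) \<and>
        (\<forall>h. blinfun_apply j h = (\<Sum>t\<le>T. 2 * (fst (soft_param D f x0 y0 p t) \<bullet> (cost_Qx D *v X t h)))
                  + c3 * (\<Sum>t\<le>T. blinfun_apply (n t) (snd (Z t h))))}"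

text \<open>Calmness at \<open>p\<close>, with modulus \<open>a\<close>, of minimizing \<open>C\<close> subject to \<open>E p t = 0\<close> for all \<open>t \<le> T\<close>.\<close>

definition calm_with_modulus ::
  "'p::metric_space set \<Rightarrow> nat \<Rightarrow> ('p \<Rightarrow> real) \<Rightarrow> ('p \<Rightarrow> nat \<Rightarrow> 'e::real_normed_vector) \<Rightarrow> 'p \<Rightarrow> real \<Rightarrow> bool" where
  "calm_with_modulus S T C E p a \<longleftrightarrow>
     (\<forall>t\<le>T. E p t = 0) \<and> 0 \<le> a \<and>
     (\<exists>r>0. \<forall>p'\<in>S. \<forall>u. dist p' p \<le> r \<and> (\<forall>t\<le>T. E p' t = u t) \<longrightarrow>
        C p' + a * L2_set (\<lambda>t. norm (u t)) {..T} \<ge> C p)"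

end

theory Submission
  imports Defs
begin

text \<open>
  Calmness at \<open>pstar\<close> includes that \<open>pstar\<close> is feasible for the problem of minimizing \<open>C p\<close>
  subject to \<open>\<epsilon> p = 0\<close>, so every slack computed along the soft-constrained closed loop for
  \<open>pstar\<close> vanishes. It remains to see that a soft-constrained problem whose optimal
  slack is zero has the same solution as the hard-constrained one.

  The plans that satisfy the hard constraints are exactly the plans that are feasible for the soft
  problem with zero slack, and on them the two costs agree. Hence a soft optimizer \<open>(y, 0)\<close> makes
  \<open>y\<close> a hard optimizer. If \<open>y'\<close> is another hard optimizer, then \<open>(y', 0)\<close> costs as much as
  \<open>(y, 0)\<close> and is a soft optimizer too; a feasible quadratic program with positive definite
  Hessian has a unique solution, so \<open>y' = y\<close> (lemma \<open>hard_optimal_iff_soft_mpc\<close>).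

  Consequently the two control laws return the same plan at every state visited by the soft loop,
  and by induction on time the hard loop never departs from the soft one. Its problems are
  therefore feasible, and since the first predicted state of a feasible plan is the current state
  and its first input is the applied input, the closed-loop constraints are constraints of the plan.
\<close>

section \<open>Strictly convex quadratic programs\<close>

text \<open>The constant is the minimum of the quadratic form on the unit sphere, which is compact.\<close>

lemma pos_def_coercive:
  fixes M :: "real^'n^'n"
  assumes "pos_def M"
  obtains m where "m > 0" "\<And>x. m * (norm x)\<^sup>2 \<le> x \<bullet> (M *v x)"
proof -
  have "continuous_on (sphere 0 1) (\<lambda>x. x \<bullet> (M *v x))"
    by (intro continuous_intros matrix_vector_mult_linear_continuous_on)
  moreover have "sphere (0::real^'n) 1 \<noteq> {}"
    by simp
  ultimately obtain x0 where x0: "x0 \<in> sphere 0 1"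
    and min: "\<And>x. x \<in> sphere 0 1 \<Longrightarrow> x0 \<bullet> (M *v x0) \<le> x \<bullet> (M *v x)"
    using continuous_attains_inf[of "sphere 0 1" "\<lambda>x. x \<bullet> (M *v x)"] by (meson compact_sphere)
  have "x0 \<noteq> 0"
    using x0 by auto
  show thesis
  proof
    show "x0 \<bullet> (M *v x0) > 0"
      using assms \<open>x0 \<noteq> 0\<close> by (simp add: pos_def_def)
    show "x0 \<bullet> (M *v x0) * (norm x)\<^sup>2 \<le> x \<bullet> (M *v x)" for x
    proof (cases "x = 0")
      case False
      define s where "s = (1 / norm x) *\<^sub>R x"
      have "s \<in> sphere 0 1" and x: "x = norm x *\<^sub>R s"
        using False by (simp_all add: s_def)
      then have "(norm x)\<^sup>2 * (x0 \<bullet> (M *v x0)) \<le> (norm x)\<^sup>2 * (s \<bullet> (M *v s))"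
        by (intro mult_left_mono min) auto
      also have "\<dots> = (norm x *\<^sub>R s) \<bullet> (M *v (norm x *\<^sub>R s))"
        by (simp add: matrix_vector_mult_scaleR power2_eq_square)
      also have "\<dots> = x \<bullet> (M *v x)"
        using x by simp
      finally show ?thesis
        by (simp add: mult.commute)
    qed simp
  qed
qed

text \<open>Coercivity confines the points that are no worse than a given feasible point to a ball, so
  that the minimum over a closed set is a minimum over a compact one.\<close>

lemma qp_cost_attains_min:
  fixes Q :: "real^'n^'n"
  assumes Q: "pos_def Q" and S: "closed S" "y1 \<in> S"
  shows "\<exists>y\<in>S. \<forall>y'\<in>S. qp_cost Q q y \<le> qp_cost Q q y'"
proof -
  obtain m where m: "m > 0" "\<And>x. m * (norm x)\<^sup>2 \<le> x \<bullet> (Q *v x)"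
    using pos_def_coercive[OF Q] by blast
  define c where "c = qp_cost Q q y1"
  define R where "R = 2 * (norm q + \<bar>c\<bar> + 1) / m + 1"
  have outside: "c < qp_cost Q q y" if "norm y > R" for y
  proof -
    have "0 \<le> 2 * (norm q + \<bar>c\<bar> + 1) / m"
      using m(1) by simp
    with that have y1: "norm y \<ge> 1" and "2 * (norm q + \<bar>c\<bar> + 1) / m \<le> norm y"
      unfolding R_def by linarith+
    then have "norm q + \<bar>c\<bar> + 1 \<le> m / 2 * norm y"
      using m(1) by (simp add: field_simps)
    then have "1 * (\<bar>c\<bar> + 1) \<le> norm y * (m / 2 * norm y - norm q)"
      using y1 by (intro mult_mono) auto
    also have "\<dots> = 1 / 2 * (m * (norm y)\<^sup>2) - norm q * norm y"
      by (simp add: algebra_simps power2_eq_square)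
    also have "\<dots> \<le> qp_cost Q q y"
      using m(2)[of y] Cauchy_Schwarz_ineq2[of q y] unfolding qp_cost_def by (simp add: abs_le_iff)
    finally show ?thesis
      by (simp add: abs_le_iff)
  qed
  have "y1 \<in> S \<inter> cball 0 R"
    using S(2) outside[of y1] by (force simp: c_def)
  moreover have "compact (S \<inter> cball 0 R)"
    using S(1) by (intro closed_Int_compact compact_cball)
  moreover have "continuous_on (S \<inter> cball 0 R) (qp_cost Q q)"
    unfolding qp_cost_def by (intro continuous_intros matrix_vector_mult_linear_continuous_on)
  ultimately obtain y where y: "y \<in> S \<inter> cball 0 R"
    and min: "\<And>y'. y' \<in> S \<inter> cball 0 R \<Longrightarrow> qp_cost Q q y \<le> qp_cost Q q y'"
    using continuous_attains_inf[of "S \<inter> cball 0 R" "qp_cost Q q"] by blast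
  have "qp_cost Q q y \<le> qp_cost Q q y'" if "y' \<in> S" for y'
  proof (cases "norm y' \<le> R")
    case False
    then show ?thesis
      using outside[of y'] min[OF \<open>y1 \<in> S \<inter> cball 0 R\<close>] unfolding c_def by simp
  qed (use that min in simp)
  then show ?thesis
    using y by blast
qed

text \<open>The parallelogram law for the quadratic form; it quantifies strict convexity.\<close>

lemma qp_cost_midpoint:
  "qp_cost Q q ((1/2) *\<^sub>R (y + y'))
     = (qp_cost Q q y + qp_cost Q q y') / 2 - 1/8 * ((y - y') \<bullet> (Q *v (y - y')))"
  by (simp add: qp_cost_def matrix_vector_mult_scaleR matrix_vector_right_distrib
      matrix_vector_mult_diff_distrib inner_add_left inner_add_right inner_diff_left
      inner_diff_right field_simps)

lemma closed_qp_feasible: "closed {y. qp_feasible F \<phi> G g y}"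
  unfolding qp_feasible_def less_eq_vec_def
  by (intro closed_Collect_conj closed_Collect_eq closed_Collect_all closed_Collect_le
      continuous_intros continuous_on_component matrix_vector_mult_linear_continuous_on)

lemma qp_feasible_midpoint:
  assumes "qp_feasible F \<phi> G g y" "qp_feasible F \<phi> G g y'"
  shows "qp_feasible F \<phi> G g ((1/2) *\<^sub>R (y + y'))"
proof -
  have "((1/2) *\<^sub>R (G *v y + G *v y')) $ i \<le> g $ i" for i
    using assms unfolding qp_feasible_def less_eq_vec_def
    by (auto dest!: spec[where x = i])
  moreover have "(1/2) *\<^sub>R (\<phi> + \<phi>) = \<phi>"
    by (simp add: scaleR_2[symmetric])
  ultimately show ?thesis
    using assms unfolding qp_feasible_def less_eq_vec_def
    by (simp add: matrix_vector_mult_scaleR matrix_vector_right_distrib)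
qed

lemma ex1_qp_minimizer:
  fixes Q :: "real^'n^'n"
  assumes Q: "pos_def Q" and feasible: "\<exists>y. qp_feasible F \<phi> G g y"
  shows "\<exists>!y. is_arg_min (qp_cost Q q) (qp_feasible F \<phi> G g) y"
proof (rule ex_ex1I)
  show "\<exists>y. is_arg_min (qp_cost Q q) (qp_feasible F \<phi> G g) y"
    using feasible qp_cost_attains_min[OF Q closed_qp_feasible]
    unfolding is_arg_min_linorder by fastforce
next
  fix y y'
  assume y: "is_arg_min (qp_cost Q q) (qp_feasible F \<phi> G g) y"
    and y': "is_arg_min (qp_cost Q q) (qp_feasible F \<phi> G g) y'"
  \<comment> \<open>If \<open>y\<close> and \<open>y'\<close> differed, their midpoint would be feasible and strictly cheaper.\<close>
  have "qp_cost Q q y \<le> qp_cost Q q ((1/2) *\<^sub>R (y + y'))"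
    "qp_cost Q q y' \<le> qp_cost Q q ((1/2) *\<^sub>R (y + y'))"
    using y y' qp_feasible_midpoint unfolding is_arg_min_linorder by blast+
  then have "(y - y') \<bullet> (Q *v (y - y')) \<le> 0"
    unfolding qp_cost_midpoint by (simp add: field_simps)
  then show "y = y'"
    using Q unfolding pos_def_def by (metis not_le right_minus_eq)
qed

section \<open>The soft-constrained problem\<close>

lemma bij_stack:
  "bij (stack :: ('nx::finite, 'nu::finite, 'h::finite) plan \<times> ('mx::finite, 'mN::finite, 'h) slack \<Rightarrow> _)"
proof (rule bijI)
  show "inj (stack :: ('nx, 'nu, 'h) plan \<times> ('mx, 'mN, 'h) slack \<Rightarrow> _)"
  proof (rule injI)
    fix z z' :: "('nx, 'nu, 'h) plan \<times> ('mx, 'mN, 'h) slack"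
    assume eq: "stack z = stack z'"
    obtain x u e eN where z: "z = ((x, u), (e, eN))"
      by (metis surj_pair)
    obtain x' u' e' eN' where z': "z' = ((x', u'), (e', eN'))"
      by (metis surj_pair)
    have entry: "stack z $ i = stack z' $ i" for i
      by (simp add: eq)
    have "x $ k $ j = x' $ k $ j" for k j
      using entry[of "Inl (Inl (k, j))"] by (simp add: z z')
    moreover have "u $ k $ j = u' $ k $ j" for k j
      using entry[of "Inl (Inr (k, j))"] by (simp add: z z')
    moreover have "e $ k $ j = e' $ k $ j" for k j
      using entry[of "Inr (Inl (k, j))"] by (simp add: z z')
    moreover have "eN $ j = eN' $ j" for j
      using entry[of "Inr (Inr j)"] by (simp add: z z')
    ultimately show "z = z'"
      by (simp add: z z' vec_eq_iff)
  qed
  show "surj (stack :: ('nx, 'nu, 'h) plan \<times> ('mx, 'mN, 'h) slack \<Rightarrow> _)"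
  proof (rule surjI)
    fix y :: "real^(('nx, 'nu, 'mx, 'mN, 'h) qp_index)"
    show "stack (((\<chi> k j. y $ Inl (Inl (k, j))), (\<chi> k j. y $ Inl (Inr (k, j)))),
                 ((\<chi> k j. y $ Inr (Inl (k, j))), (\<chi> j. y $ Inr (Inr j)))) = y"
      by (auto simp: vec_eq_iff split: sum.splits)
  qed
qed

text \<open>\<open>stack\<close> is a bijection that carries feasible points to feasible points and changes the cost by
  a constant, so the soft problem inherits its unique optimizer from its quadratic program.\<close>

lemma ex1_soft_optimal:
  assumes rep: "qp_represents D pb Q q F \<phi> G g" and Q: "pos_def Q"
    and feasible: "\<exists>y. qp_feasible F \<phi> G g y"
  shows "\<exists>!z. is_arg_min (soft_cost D (snd (snd pb))) (soft_feasible D pb) z"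
proof -
  obtain \<kappa> where feas: "\<And>z. soft_feasible D pb z \<longleftrightarrow> qp_feasible F \<phi> G g (stack z)"
    and cost: "\<And>z. soft_feasible D pb z \<Longrightarrow> soft_cost D (snd (snd pb)) z = qp_cost Q q (stack z) + \<kappa>"
    using rep unfolding qp_represents_def by blast
  have "is_arg_min (soft_cost D (snd (snd pb))) (soft_feasible D pb) z
      \<longleftrightarrow> is_arg_min (qp_cost Q q) (qp_feasible F \<phi> G g) (stack z)" for z
  proof -
    have "is_arg_min (soft_cost D (snd (snd pb))) (soft_feasible D pb) z \<longleftrightarrow>
        soft_feasible D pb z \<and> (\<forall>z'. soft_feasible D pb z' \<longrightarrow> qp_cost Q q (stack z) \<le> qp_cost Q q (stack z'))"
      unfolding is_arg_min_linorder using cost by (metis add_le_cancel_right)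
    also have "\<dots> \<longleftrightarrow> qp_feasible F \<phi> G g (stack z) \<and>
        (\<forall>y'. qp_feasible F \<phi> G g y' \<longrightarrow> qp_cost Q q (stack z) \<le> qp_cost Q q y')"
      unfolding feas using bij_is_surj[OF bij_stack] by (metis surjD)
    finally show ?thesis
      unfolding is_arg_min_linorder .
  qed
  then show ?thesis
    using ex1_qp_minimizer[OF Q feasible] bij_stack unfolding bij_iff by metis
qed

lemma soft_mpc_optimal:
  assumes "\<exists>!z. is_arg_min (soft_cost D (snd (snd pb))) (soft_feasible D pb) z"
  shows "is_arg_min (soft_cost D (snd (snd pb))) (soft_feasible D pb) (soft_mpc D pb)"
  using assms unfolding soft_mpc_def arg_min_def by (metis (lifting) someI_ex)

section \<open>Vanishing slack and the hard-constrained problem\<close>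

lemma hard_feasible_iff_soft_zero_slack:
  "hard_feasible D pb y \<longleftrightarrow> soft_feasible D pb (y, 0)"
  by (cases pb; cases y) (auto simp: zero_prod_def)

lemma soft_cost_zero_slack: "soft_cost D p (y, 0) = mpc_cost D p y"
  by (simp add: norm1_def)

text \<open>The hard problem is the soft problem restricted to zero slack. When the restriction contains
  the optimizer of the soft problem, both have the same value, so every hard optimizer is also a
  soft one and uniqueness transfers.\<close>

lemma hard_optimal_iff_soft_mpc:
  assumes ex1: "\<exists>!z. is_arg_min (soft_cost D (snd (snd pb))) (soft_feasible D pb) z"
    and slack: "snd (soft_mpc D pb) = 0"
  shows "hard_optimal D pb y \<longleftrightarrow> y = fst (soft_mpc D pb)"
proof -
  let ?y = "fst (soft_mpc D pb)"
  have soft: "soft_mpc D pb = (?y, 0)"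
    using slack by (metis prod.collapse)
  have opt: "is_arg_min (soft_cost D (snd (snd pb))) (soft_feasible D pb) (?y, 0)"
    using soft_mpc_optimal[OF ex1] soft by simp
  show ?thesis
  proof
    assume "y = ?y"
    then show "hard_optimal D pb y"
      using opt unfolding hard_optimal_def is_arg_min_linorder hard_feasible_iff_soft_zero_slack
      by (metis soft_cost_zero_slack)
  next
    assume y: "hard_optimal D pb y"
    then have "mpc_cost D (snd (snd pb)) y \<le> mpc_cost D (snd (snd pb)) ?y"
      using opt unfolding hard_optimal_def is_arg_min_linorder hard_feasible_iff_soft_zero_slack
      by blast
    then have "is_arg_min (soft_cost D (snd (snd pb))) (soft_feasible D pb) (y, 0)"
      using y opt unfolding hard_optimal_def is_arg_min_linorder hard_feasible_iff_soft_zero_slack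
        soft_cost_zero_slack by (blast intro: order_trans)
    then show "y = ?y"
      using ex1 opt by blast
  qed
qed

lemma hard_mpc_eq_soft_mpc:
  assumes "\<exists>!z. is_arg_min (soft_cost D (snd (snd pb))) (soft_feasible D pb) z"
    and "snd (soft_mpc D pb) = 0"
  shows "hard_mpc D pb = fst (soft_mpc D pb)"
  using hard_optimal_iff_soft_mpc[OF assms]
  unfolding hard_mpc_def arg_min_def hard_optimal_def by (intro some_equality) simp_all

section \<open>Closed loops\<close>

text \<open>The control laws need to agree only where the first loop goes: slacks are known to vanish along
  the soft-constrained loop, not at arbitrary states.\<close>

lemma closed_loop_param_cong:
  assumes "\<And>s. s < t \<Longrightarrow> K (closed_loop_param f K x0 y0 p s) = K' (closed_loop_param f K x0 y0 p s)"
  shows "closed_loop_param f K' x0 y0 p t = closed_loop_param f K x0 y0 p t"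
proof -
  have "closed_loop f K' x0 y0 p t = closed_loop f K x0 y0 p t"
    using assms
  proof (induction t)
    case (Suc t)
    then have "closed_loop f K' x0 y0 p t = closed_loop f K x0 y0 p t"
      by simp
    then show ?case
      using Suc.prems[of t]
        by (cases "closed_loop f K x0 y0 p t") (simp add: closed_loop_param_def)
  qed simp
  then show ?thesis
    by (simp add: closed_loop_param_def)
qed

lemma design_param_closed_loop: "snd (snd (closed_loop_param f K x0 y0 p t)) = p"
  by (simp add: closed_loop_param_def split: prod.splits)

lemma hard_feasible_initial_constraints:
  assumes "hard_feasible D pb y"
  shows "con_Hx D (snd (snd pb)) *v fst pb \<le> con_hx D (snd (snd pb))"
    and "con_Hu D (snd (snd pb)) *v first_input y \<le> con_hu D (snd (snd pb))"
  using assms by (cases pb; cases y; auto simp: first_input_def)+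

theorem theorem3:
  fixes D :: "('nx::finite, 'nu::finite, 'np::finite, 'mx::finite, 'mu::finite, 'mN::finite,
               'h::{finite,linorder}) mpc"
    and f :: "(real^'nx) \<times> (real^'nu) \<Rightarrow> real^'nx"
    and x0 :: "real^'nx" and y0 :: "('nx, 'nu, 'h) plan"
    and T :: nat and PP :: "(real^'np) set" and YY :: "('nx, 'nu, 'np, 'h) qparam set"
    and Om :: "nat \<Rightarrow> real list set set"
    and Q :: "('nx, 'nu, 'np, 'h) qparam \<Rightarrow>
                real^(('nx, 'nu, 'mx, 'mN, 'h) qp_index)^(('nx, 'nu, 'mx, 'mN, 'h) qp_index)"
    and q :: "('nx, 'nu, 'np, 'h) qparam \<Rightarrow> real^(('nx, 'nu, 'mx, 'mN, 'h) qp_index)"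
    and F :: "('nx, 'nu, 'np, 'h) qparam \<Rightarrow> real^(('nx, 'nu, 'mx, 'mN, 'h) qp_index)^('e::finite)"
    and \<phi> :: "('nx, 'nu, 'np, 'h) qparam \<Rightarrow> real^'e"
    and G :: "('nx, 'nu, 'np, 'h) qparam \<Rightarrow> real^(('nx, 'nu, 'mx, 'mN, 'h) qp_index)^('i::finite)"
    and g :: "('nx, 'nu, 'np, 'h) qparam \<Rightarrow> real^'i"
    and JS :: "('nx, 'nu, 'np, 'h) qparam \<Rightarrow>
                 (('nx, 'nu, 'np, 'h) qparam \<Rightarrow>\<^sub>L (('nx, 'nu, 'h) plan \<times> ('mx, 'mN, 'h) slack)) set"
    and Jf :: "(real^'nx) \<times> (real^'nu) \<Rightarrow> (((real^'nx) \<times> (real^'nu)) \<Rightarrow>\<^sub>L (real^'nx)) set"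
    and Jn :: "('mx, 'mN, 'h) slack \<Rightarrow> (('mx, 'mN, 'h) slack \<Rightarrow>\<^sub>L real) set"
    and \<alpha> :: "nat \<Rightarrow> real" and p :: "nat \<Rightarrow> real^'np" and pstar :: "real^'np"
    and c3 :: real and a :: real
  assumes T: "T > 0"
    and PP: "polytope PP"
    and Qx: "pos_def (cost_Qx D)"
    and c1: "pen_c1 D > 0" and c2: "pen_c2 D > 0"
    and inputs: "\<And>p. p \<in> PP \<Longrightarrow> \<exists>u. con_Hu D p *v u \<le> con_hu D p"
    and Om: "o_minimal Om"
    and YY: "polytope YY"
    and YY_closed_loop: "\<And>p t. p \<in> PP \<Longrightarrow> t \<le> T \<Longrightarrow> soft_param D f x0 y0 p t \<in> YY"
    and A1: "\<And>pb. pb \<in> YY \<Longrightarrow>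
               qp_represents D pb (Q pb) (q pb) (F pb) (\<phi> pb) (G pb) (g pb) \<and>
               pos_def (Q pb) \<and>
               (\<exists>y. qp_feasible (F pb) (\<phi> pb) (G pb) (g pb) y) \<and>
               licq (Q pb) (q pb) (F pb) (\<phi> pb) (G pb) (g pb)"
    and A2_lipschitz: "locally_lipschitz_on YY Q" "locally_lipschitz_on YY q"
               "locally_lipschitz_on YY F" "locally_lipschitz_on YY \<phi>"
               "locally_lipschitz_on YY G" "locally_lipschitz_on YY g"
    and A2_definable: "definable_on Om YY Q" "definable_on Om YY q" "definable_on Om YY F"
               "definable_on Om YY \<phi>" "definable_on Om YY G" "definable_on Om YY g"
    and A3: "locally_lipschitz_on UNIV f" "definable_on Om UNIV f"
    and JS: "conservative_jacobian_on YY (soft_mpc D) JS"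
    and Jf: "conservative_jacobian_on UNIV f Jf"
    and Jn: "conservative_jacobian_on UNIV norm1 Jn"
    and J: "conservative_jacobian_on PP (penalized_cost D f x0 y0 T c3)
              (chain_rule_jacobian D f x0 y0 T c3 JS Jf Jn)"
    and scheme: "projected_gradient PP (chain_rule_jacobian D f x0 y0 T c3 JS Jf Jn) \<alpha> p"
    and limit: "p \<longlonglongrightarrow> pstar"
    and local_min: "local_minimizer_on PP (penalized_cost D f x0 y0 T c3) pstar"
    and calm: "calm_with_modulus PP T (cl_cost D f x0 y0 T) (cl_slack D f x0 y0) pstar a"
    and c2_large: "\<And>t y. t \<le> T \<Longrightarrow> hard_optimal D (soft_param D f x0 y0 pstar t) y \<Longrightarrow>
              \<exists>l. state_multiplier D (soft_param D f x0 y0 pstar t) y l \<and> infnorm l < pen_c2 D"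
    and c3_large: "c3 \<ge> a"
  shows "\<forall>t\<le>T.
           (\<exists>y. hard_feasible D (hard_param D f x0 y0 pstar t) y) \<and>
           (\<exists>!y. hard_optimal D (hard_param D f x0 y0 pstar t) y) \<and>
           con_Hx D pstar *v fst (hard_param D f x0 y0 pstar t) \<le> con_hx D pstar \<and>
           con_Hu D pstar *v first_input (hard_mpc D (hard_param D f x0 y0 pstar t)) \<le> con_hu D pstar"
proof -
  have pstar: "pstar \<in> PP"
    using local_min by (simp add: local_minimizer_on_def)
  have ex1: "\<exists>!z. is_arg_min (soft_cost D (snd (snd pb))) (soft_feasible D pb) z"
    if "pb = soft_param D f x0 y0 pstar t" "t \<le> T" for pb t
    using A1[OF YY_closed_loop[OF pstar that(2)]] ex1_soft_optimal that(1) by blast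
  have slack: "snd (soft_mpc D (soft_param D f x0 y0 pstar t)) = 0" if "t \<le> T" for t
    using calm that by (simp add: calm_with_modulus_def cl_slack_def)
  have same_loop: "hard_param D f x0 y0 pstar t = soft_param D f x0 y0 pstar t" if "t \<le> T" for t
    unfolding hard_param_def soft_param_def
  proof (rule closed_loop_param_cong)
    fix s
    assume "s < t"
    with that have "s \<le> T"
      by simp
    then show "fst (soft_mpc D (closed_loop_param f (\<lambda>pb. fst (soft_mpc D pb)) x0 y0 pstar s)) =
        hard_mpc D (closed_loop_param f (\<lambda>pb. fst (soft_mpc D pb)) x0 y0 pstar s)"
      using hard_mpc_eq_soft_mpc[OF ex1[OF refl] slack] by (simp add: soft_param_def)
  qed
  show ?thesis
  proof (intro allI impI)
    fix t
    assume t: "t \<le> T"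
    define pb where "pb = hard_param D f x0 y0 pstar t"
    have soft: "pb = soft_param D f x0 y0 pstar t"
      using same_loop[OF t] by (simp add: pb_def)
    have zero: "snd (soft_mpc D pb) = 0"
      using slack[OF t] soft by simp
    note opt = hard_optimal_iff_soft_mpc[OF ex1[OF soft t] zero]
    have "hard_optimal D pb (hard_mpc D pb)"
      unfolding opt by (rule hard_mpc_eq_soft_mpc[OF ex1[OF soft t] zero])
    then have feas: "hard_feasible D pb (hard_mpc D pb)"
      by (simp add: hard_optimal_def is_arg_min_def)
    have design: "snd (snd pb) = pstar"
      by (simp add: pb_def hard_param_def design_param_closed_loop)
    have "\<exists>!y. hard_optimal D pb y"
      unfolding opt by (rule ex1_eq)
    then show "(\<exists>y. hard_feasible D (hard_param D f x0 y0 pstar t) y) \<and>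
        (\<exists>!y. hard_optimal D (hard_param D f x0 y0 pstar t) y) \<and>
        con_Hx D pstar *v fst (hard_param D f x0 y0 pstar t) \<le> con_hx D pstar \<and>
        con_Hu D pstar *v first_input (hard_mpc D (hard_param D f x0 y0 pstar t)) \<le> con_hu D pstar"
      using feas hard_feasible_initial_constraints[OF feas, unfolded design]
      unfolding pb_def[symmetric] by blast
  qed
qed

end
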